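(* Let $\Omega\subset\mathbb R^n$ be a Borel set. (1) Let $C\subset\overline\Omega$ be closed. Then $$M_C:=\{\mu\in\mathrm{ba}(\Omega,\mathcal B(\Omega),\mathcal L^n)\mid \operatorname{core}\mu\subset C,\ \mu\ge0,\ \mu(C_\delta\cap\Omega)=\mu(\Omega)=1\text{ for all }\delta>0\}$$ is a weak$^*$ compact convex subset of $\mathrm{ba}(\Omega,\mathcal B(\Omega),\mathcal L^n)$. (2) Let $C\subset\overline\Omega$ be nonempty and closed with $\mathcal L^n(C\cap\Omega)=0$, and let $\mu_k\in\mathrm{ba}(\Omega,\mathcal B(\Omega),\mathcal L^n)$, $k\in\mathbb N$, be density measures (on $\Omega$, each at some set) with $\operatorname{core}\mu_k\subset C_{\delta_k}$ for some sequence $\delta_k\downarrow0$. Then $\{\mu_k\}$ has a weak$^*$ accumulation point $\mu\in\mathrm{Dens}_C$, and for any $f\in L^\infty(\Omega,\mathbb R^m)$ there is a subsequence $\{\mu_{k'}\}$, depending on $f$, such that $$\int_\Omega f\,d\mu=\lim_{k'\to\infty}\int_\Omega f\,d\mu_{k'} .$$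
   Context: $\mathcal L^n$ is Lebesgue measure, $\mathcal B(\Omega)$ the Borel subsets of $\Omega$, and $\overline\Omega$ the closure of $\Omega$ in $\mathbb R^n$. $\mathrm{ba}(\Omega,\mathcal B(\Omega),\mathcal L^n)$ is the space of bounded finitely additive set functions $\mu:\mathcal B(\Omega)\to\mathbb R$ with $\mu(A)=0$ whenever $\mathcal L^n(A)=0$, normed by total variation $|\mu|(\Omega)$. It is identified with the dual of $L^\infty(\Omega)$ (classes of $\mathcal L^n$-essentially bounded functions) via $\langle\mu,f\rangle=\int_\Omega f\,d\mu$, where the integral of Borel step functions is the obvious finite sum, extended by uniform approximation; weak$^*$ refers to this duality. Integrals of vector functions are componentwise. $\mathbb R^n\cup\{\infty\}$ is the one-point compactification with $B_\delta(\infty)=\{\infty\}\cup\{y:|y|>1/\delta\}$. $\operatorname{core}\mu$ is the set of all $x\in\mathbb R^n\cup\{\infty\}$ such that $|\mu|(U\cap\Omega)>0$ for every open $U\subset\mathbb R^n\cup\{\infty\}$ containing $x$. $C_\delta$ is the open $\delta$-neighborhood of $C\subset\mathbb R^n$, and $\{\infty\}_\delta=B_\delta(\infty)$. For a nonempty closed $C\subset\overline\Omega$ with $\mathcal L^n(C\cap\Omega)=0$, or $C=\{\infty\}$, $\mathrm{Dens}_C$ (the density measures at $C$ on $\Omega$) is the set of all $\mu\in\mathrm{ba}(\Omega,\mathcal B(\Omega),\mathcal L^n)$ with $\mu\ge0$ and $\mu(C_\delta\cap\Omega)=\mu(\Omega)=1$ for all $\delta>0$.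
   Formalization: In (1), weak* compactness of M_C is claimed only for bounded C (it fails for Ω=C=ℝ with uniform measures on [k,k+1]); for every closed C, compactness and convexity are shown with core μ contained in the closure of C in ℝⁿ∪{∞}. *)

theory Defs
  imports "HOL-Analysis.Analysis"
begin

section \<open>Bounded finitely additive measures\<close>

text \<open>The measurable sets of \<open>restrict_space borel \<Omega>\<close> are the Borel subsets of \<open>\<Omega>\<close>
  (for Borel \<open>\<Omega>\<close>). A set function on them is represented by its extension by \<open>0\<close> to all
  sets, so that equal set functions are equal terms.\<close>

abbreviation borel_subsets :: "'a::euclidean_space set \<Rightarrow> 'a set set" where
  "borel_subsets \<Omega> \<equiv> sets (restrict_space borel \<Omega>)"

definition ba :: "'a::euclidean_space set \<Rightarrow> ('a set \<Rightarrow> real) set" where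
  "ba \<Omega> = {\<mu>.
     (\<forall>A. A \<notin> borel_subsets \<Omega> \<longrightarrow> \<mu> A = 0) \<and>
     (\<exists>K. \<forall>A \<in> borel_subsets \<Omega>. \<bar>\<mu> A\<bar> \<le> K) \<and>
     (\<forall>A \<in> borel_subsets \<Omega>. \<forall>B \<in> borel_subsets \<Omega>. A \<inter> B = {} \<longrightarrow> \<mu> (A \<union> B) = \<mu> A + \<mu> B) \<and>
     (\<forall>A \<in> borel_subsets \<Omega>. A \<in> null_sets lborel \<longrightarrow> \<mu> A = 0)}"

definition nonneg :: "'a::euclidean_space set \<Rightarrow> ('a set \<Rightarrow> real) \<Rightarrow> bool" where
  "nonneg \<Omega> \<mu> \<longleftrightarrow> (\<forall>A \<in> borel_subsets \<Omega>. 0 \<le> \<mu> A)"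

definition total_variation ::
    "'a::euclidean_space set \<Rightarrow> ('a set \<Rightarrow> real) \<Rightarrow> 'a set \<Rightarrow> real" where
  "total_variation \<Omega> \<mu> A =
     (SUP P \<in> {P. finite P \<and> disjoint P \<and> P \<subseteq> borel_subsets \<Omega> \<and> \<Union>P = A}. \<Sum>B\<in>P. \<bar>\<mu> B\<bar>)"

text \<open>The library has no vector space structure on function types, hence no \<^const>\<open>convex\<close>
  for sets of set functions.\<close>

definition ba_convex :: "('a set \<Rightarrow> real) set \<Rightarrow> bool" where
  "ba_convex M \<longleftrightarrow>
     (\<forall>\<mu>\<in>M. \<forall>\<nu>\<in>M. \<forall>t\<in>{0..1}. (\<lambda>A. (1 - t) * \<mu> A + t * \<nu> A) \<in> M)"


section \<open>The pairing with essentially bounded functions and the weak* topology\<close>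

text \<open>\<open>Linf \<Omega>\<close> consists of representatives: members that agree almost everywhere on \<open>\<Omega>\<close>
  stand for the same class, and \<open>ba_integral\<close> below does not distinguish them.\<close>

definition Linf :: "'a::euclidean_space set \<Rightarrow> ('a \<Rightarrow> real) set" where
  "Linf \<Omega> = {f. f \<in> borel_measurable (lebesgue_on \<Omega>) \<and>
                (\<exists>K. AE x in lebesgue_on \<Omega>. \<bar>f x\<bar> \<le> K)}"

definition step_integral ::
    "'a::euclidean_space set \<Rightarrow> ('a set \<Rightarrow> real) \<Rightarrow> ('a \<Rightarrow> real) \<Rightarrow> real" where
  "step_integral \<Omega> \<mu> h = (\<Sum>c \<in> h ` \<Omega>. c * \<mu> (h -` {c} \<inter> \<Omega>))"

definition has_ba_integral ::
    "'a::euclidean_space set \<Rightarrow> ('a set \<Rightarrow> real) \<Rightarrow> ('a \<Rightarrow> real) \<Rightarrow> real \<Rightarrow> bool" where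
  "has_ba_integral \<Omega> \<mu> f I \<longleftrightarrow>
     (\<exists>h :: nat \<Rightarrow> 'a \<Rightarrow> real.
        (\<forall>k. simple_function (restrict_space borel \<Omega>) (h k)) \<and>
        (\<forall>\<epsilon>>0. \<forall>\<^sub>F k in sequentially. AE x in lebesgue_on \<Omega>. \<bar>h k x - f x\<bar> \<le> \<epsilon>) \<and>
        (\<lambda>k. step_integral \<Omega> \<mu> (h k)) \<longlonglongrightarrow> I)"

definition ba_integral ::
    "'a::euclidean_space set \<Rightarrow> ('a set \<Rightarrow> real) \<Rightarrow> ('a \<Rightarrow> real) \<Rightarrow> real" where
  "ba_integral \<Omega> \<mu> f = (THE I. has_ba_integral \<Omega> \<mu> f I)"

text \<open>The coarsest topology on \<open>ba \<Omega>\<close> making all the evaluations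
  \<open>\<lambda>\<mu>. ba_integral \<Omega> \<mu> f\<close>, \<open>f \<in> Linf \<Omega>\<close>, continuous.\<close>

definition weakstar :: "'a::euclidean_space set \<Rightarrow> ('a set \<Rightarrow> real) topology" where
  "weakstar \<Omega> =
     pullback_topology (ba \<Omega>) (\<lambda>\<mu>. \<lambda>f\<in>Linf \<Omega>. ba_integral \<Omega> \<mu> f)
       (product_topology (\<lambda>_. euclideanreal) (Linf \<Omega>))"

lemma topspace_weakstar [simp]: "topspace (weakstar \<Omega>) = ba \<Omega>"
  unfolding weakstar_def topspace_pullback_topology by auto

definition weakstar_accumulation_point ::
    "'a::euclidean_space set \<Rightarrow> (nat \<Rightarrow> 'a set \<Rightarrow> real) \<Rightarrow> ('a set \<Rightarrow> real) \<Rightarrow> bool" where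
  "weakstar_accumulation_point \<Omega> \<mu> \<nu> \<longleftrightarrow>
     \<nu> \<in> ba \<Omega> \<and> (\<forall>U. openin (weakstar \<Omega>) U \<and> \<nu> \<in> U \<longrightarrow> infinite {k. \<mu> k \<in> U})"


section \<open>Cores and density measures\<close>

text \<open>A point \<open>x\<close> of the one-point compactification is \<open>Some x\<close>, and \<open>None\<close> is \<open>\<infinity>\<close>.\<close>

abbreviation compactified :: "'a::euclidean_space option topology" where
  "compactified \<equiv> Alexandroff_compactification euclidean"

fun point_nhd :: "real \<Rightarrow> 'a::euclidean_space option \<Rightarrow> 'a option set" where
  "point_nhd \<delta> (Some x) = Some ` ball x \<delta>"
| "point_nhd \<delta> None = insert None (Some ` {y. norm y > 1 / \<delta>})"

definition nhd :: "real \<Rightarrow> 'a::euclidean_space option set \<Rightarrow> 'a option set" where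
  "nhd \<delta> K = (\<Union>x\<in>K. point_nhd \<delta> x)"

definition core :: "'a::euclidean_space set \<Rightarrow> ('a set \<Rightarrow> real) \<Rightarrow> 'a option set" where
  "core \<Omega> \<mu> = {x. \<forall>U. openin compactified U \<and> x \<in> U
                     \<longrightarrow> total_variation \<Omega> \<mu> (Some -` U \<inter> \<Omega>) > 0}"

definition concentrated_at ::
    "'a::euclidean_space set \<Rightarrow> 'a option set \<Rightarrow> ('a set \<Rightarrow> real) \<Rightarrow> bool" where
  "concentrated_at \<Omega> K \<mu> \<longleftrightarrow> (\<forall>\<delta>>0. \<mu> (Some -` nhd \<delta> K \<inter> \<Omega>) = \<mu> \<Omega> \<and> \<mu> \<Omega> = 1)"

definition M_set :: "'a::euclidean_space set \<Rightarrow> 'a set \<Rightarrow> ('a set \<Rightarrow> real) set" where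
  "M_set \<Omega> C = {\<mu> \<in> ba \<Omega>. core \<Omega> \<mu> \<subseteq> Some ` C \<and> nonneg \<Omega> \<mu> \<and> concentrated_at \<Omega> (Some ` C) \<mu>}"

text \<open>For unbounded \<open>C\<close> the condition \<open>core \<Omega> \<mu> \<subseteq> Some ` C\<close> excludes \<open>\<infinity>\<close> from the core and is
  not weak* closed: for \<open>\<Omega> = C = \<real>\<close>, the uniform distributions on \<open>[k, k + 1]\<close> lie in
  \<open>M_set \<Omega> C\<close>, but all their weak* accumulation points have core \<open>{\<infinity>}\<close>. The inclusion has to
  be read with the closure of \<open>C\<close> in the compactification, which is \<open>C\<close> itself if \<open>C\<close> is
  compact and \<open>C \<union> {\<infinity>}\<close> if \<open>C\<close> is closed and unbounded.\<close>

definition M_set_closure :: "'a::euclidean_space set \<Rightarrow> 'a set \<Rightarrow> ('a set \<Rightarrow> real) set" where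
  "M_set_closure \<Omega> C =
     {\<mu> \<in> ba \<Omega>. core \<Omega> \<mu> \<subseteq> compactified closure_of (Some ` C) \<and>
                nonneg \<Omega> \<mu> \<and> concentrated_at \<Omega> (Some ` C) \<mu>}"

definition density_site :: "'a::euclidean_space set \<Rightarrow> 'a option set \<Rightarrow> bool" where
  "density_site \<Omega> K \<longleftrightarrow>
     K = {None} \<or>
     (\<exists>C. K = Some ` C \<and> C \<noteq> {} \<and> closed C \<and> C \<subseteq> closure \<Omega> \<and> C \<inter> \<Omega> \<in> null_sets lborel)"

definition Dens :: "'a::euclidean_space set \<Rightarrow> 'a option set \<Rightarrow> ('a set \<Rightarrow> real) set" where
  "Dens \<Omega> K = {\<mu> \<in> ba \<Omega>. nonneg \<Omega> \<mu> \<and> concentrated_at \<Omega> K \<mu>}"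

definition density_measure :: "'a::euclidean_space set \<Rightarrow> ('a set \<Rightarrow> real) \<Rightarrow> bool" where
  "density_measure \<Omega> \<mu> \<longleftrightarrow> (\<exists>K. density_site \<Omega> K \<and> \<mu> \<in> Dens \<Omega> K)"

end

theory Submission
  imports Defs
begin

text \<open>A nonnegative element of \<open>ba \<Omega>\<close> of total mass \<open>1\<close> is a point of the cube \<open>[0, 1]\<close> to the power
  of all subsets, cut out by equations and inequalities between finitely many coordinates; these
  set functions thus form a compact set for pointwise convergence. On it, the integral of
  \<open>f \<in> Linf \<Omega>\<close> is a uniform limit of integrals of step functions, hence pointwise continuous, so
  that compactness and cluster points pass from the pointwise to the weak* topology. Dually, the
  core lies in an open set \<open>V\<close> only if \<open>V\<close> has full mass, since finitely many null open sets
  cover the compact complement of \<open>V\<close>; this gives the mass of the neighborhoods of \<open>C\<close> in the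
  limit, and conversely concentration at \<open>C\<close> forces the core into the closure of \<open>C\<close>.\<close>

section \<open>Finite additivity and total variation\<close>

lemma borel_subsets_iff:
  assumes "\<Omega> \<in> sets borel"
  shows "A \<in> borel_subsets \<Omega> \<longleftrightarrow> A \<in> sets borel \<and> A \<subseteq> \<Omega>"
  using assms by (auto simp: sets_restrict_space_iff)

lemma ba_additive:
  assumes "\<mu> \<in> ba \<Omega>" "A \<in> borel_subsets \<Omega>" "B \<in> borel_subsets \<Omega>" "A \<inter> B = {}"
  shows "\<mu> (A \<union> B) = \<mu> A + \<mu> B"
  using assms unfolding ba_def by blast

lemma ba_empty:
  assumes "\<mu> \<in> ba \<Omega>"
  shows "\<mu> {} = 0"
  using ba_additive[OF assms, of "{}" "{}"] by simp

lemma ba_UN: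
  assumes "\<mu> \<in> ba \<Omega>" "finite I" "\<And>i. i \<in> I \<Longrightarrow> A i \<in> borel_subsets \<Omega>" "disjoint_family_on A I"
  shows "\<mu> (\<Union>i\<in>I. A i) = (\<Sum>i\<in>I. \<mu> (A i))"
  using assms(2-)
proof (induction I)
  case empty
  then show ?case using ba_empty[OF assms(1)] by simp
next
  case (insert i I)
  have "A i \<inter> (\<Union>j\<in>I. A j) = {}"
    using insert.hyps insert.prems(2) by (fastforce simp: disjoint_family_on_def)
  moreover have "(\<Union>j\<in>I. A j) \<in> borel_subsets \<Omega>"
    using insert by (intro sets.finite_UN) auto
  moreover have "disjoint_family_on A I"
    using insert.prems(2) by (auto simp: disjoint_family_on_def)
  ultimately show ?case
    using insert by (simp add: ba_additive[OF assms(1)])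
qed

lemma ba_mono:
  assumes "\<mu> \<in> ba \<Omega>" "nonneg \<Omega> \<mu>" "A \<in> borel_subsets \<Omega>" "B \<in> borel_subsets \<Omega>" "A \<subseteq> B"
  shows "\<mu> A \<le> \<mu> B"
proof -
  have "B - A \<in> borel_subsets \<Omega>" "A \<union> (B - A) = B"
    using assms by auto
  then show ?thesis
    using ba_additive[OF assms(1,3), of "B - A"] assms(2) by (auto simp: nonneg_def)
qed

text \<open>For nonnegative \<open>\<mu>\<close> additivity gives every finite partition of
  \<open>A\<close> the same sum, so the supremum runs over a single value. The partition
  \<open>{A}\<close> shows that the supremum is not over the empty set.\<close>

lemma total_variation_nonneg:
  assumes "\<mu> \<in> ba \<Omega>" "nonneg \<Omega> \<mu>" "A \<in> borel_subsets \<Omega>"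
  shows "total_variation \<Omega> \<mu> A = \<mu> A"
proof -
  let ?\<P> = "{P. finite P \<and> disjoint P \<and> P \<subseteq> borel_subsets \<Omega> \<and> \<Union>P = A}"
  have "(\<Sum>B\<in>P. \<bar>\<mu> B\<bar>) = \<mu> A" if "P \<in> ?\<P>" for P
  proof -
    have "(\<Sum>B\<in>P. \<bar>\<mu> B\<bar>) = (\<Sum>B\<in>P. \<mu> B)"
      using that assms(2) by (intro sum.cong) (auto simp: nonneg_def)
    also have "\<dots> = \<mu> (\<Union>B\<in>P. B)"
      using that by (subst ba_UN[OF assms(1)]) (auto simp: disjoint_family_on_def disjoint_def)
    finally show ?thesis using that by simp
  qed
  moreover have "{A} \<in> ?\<P>"
    using assms(3) by auto
  ultimately have "(\<lambda>P. \<Sum>B\<in>P. \<bar>\<mu> B\<bar>) ` ?\<P> = {\<mu> A}"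
    by (auto simp: image_iff intro!: bexI[of _ "{A}"])
  then show ?thesis
    unfolding total_variation_def by simp
qed

section \<open>Finitely additive probabilities\<close>

text \<open>A common home for \<open>M_set\<close>, \<open>M_set_closure\<close> and
  \<open>Dens\<close>, independent of \<open>C\<close>: the mass one is contained in
  \<open>concentrated_at\<close>. Continuity of the integrals and compactness are shown on this set
  once and for all.\<close>

definition fa_prob :: "'a::euclidean_space set \<Rightarrow> ('a set \<Rightarrow> real) set" where
  "fa_prob \<Omega> = {\<mu> \<in> ba \<Omega>. nonneg \<Omega> \<mu> \<and> \<mu> \<Omega> = 1}"

lemma fa_probD:
  assumes "\<mu> \<in> fa_prob \<Omega>"
  shows "\<mu> \<in> ba \<Omega>" "nonneg \<Omega> \<mu>" "\<mu> \<Omega> = 1"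
  using assms by (auto simp: fa_prob_def)

text \<open>If \<open>P\<close> failed on all of \<open>A\<close>, then \<open>A\<close> would lie
  in the exceptional null set. This links the completed measure, in which essential bounds are
  stated, with the Borel null sets, on which elements of \<open>ba \<Omega>\<close> vanish.\<close>

lemma borel_subsets_AE:
  assumes "\<Omega> \<in> sets borel" "A \<in> borel_subsets \<Omega>" "A \<notin> null_sets lborel"
    and "AE x in lebesgue_on \<Omega>. P x"
  obtains x where "x \<in> A" "P x"
proof -
  have A: "A \<in> sets borel" "A \<subseteq> \<Omega>"
    using assms borel_subsets_iff by auto
  have "AE x in lborel. x \<in> \<Omega> \<longrightarrow> P x"
    using assms(1,4) by (subst (asm) AE_restrict_space_iff) (auto simp: AE_completion_iff)
  then have "A \<in> null_sets lborel" if "\<forall>x\<in>A. \<not> P x"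
    using that A by (subst AE_iff_null_sets) (auto elim!: eventually_mono)
  then show ?thesis
    using assms(3) that by blast
qed

section \<open>Step integrals\<close>

lemma simple_function_level_sets:
  assumes "simple_function (restrict_space borel \<Omega>) h"
  shows "finite (h ` \<Omega>)" "c \<in> h ` \<Omega> \<Longrightarrow> h -` {c} \<inter> \<Omega> \<in> borel_subsets \<Omega>"
  using assms by (auto simp: simple_function_def space_restrict_space)

lemma ba_sum_level_sets:
  assumes "\<mu> \<in> ba \<Omega>" "simple_function (restrict_space borel \<Omega>) h"
    and A: "A \<in> borel_subsets \<Omega>" "A \<subseteq> \<Omega>"
  shows "\<mu> A = (\<Sum>c\<in>h ` \<Omega>. \<mu> (A \<inter> (h -` {c} \<inter> \<Omega>)))"
proof -
  have "A = (\<Union>c\<in>h ` \<Omega>. A \<inter> (h -` {c} \<inter> \<Omega>))"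
    using A(2) by auto
  then have "\<mu> A = \<mu> (\<Union>c\<in>h ` \<Omega>. A \<inter> (h -` {c} \<inter> \<Omega>))"
    by simp
  also have "\<dots> = (\<Sum>c\<in>h ` \<Omega>. \<mu> (A \<inter> (h -` {c} \<inter> \<Omega>)))"
    by (intro ba_UN[OF assms(1)] sets.Int A(1) simple_function_level_sets[OF assms(2)])
      (auto simp: disjoint_family_on_def)
  finally show ?thesis .
qed

text \<open>Splitting the level sets of \<open>h\<close> along those of \<open>g\<close> lets two
  step integrals be compared cell by cell.\<close>

lemma step_integral_refine:
  assumes "\<mu> \<in> ba \<Omega>"
    and h: "simple_function (restrict_space borel \<Omega>) h"
    and g: "simple_function (restrict_space borel \<Omega>) g"
  shows "step_integral \<Omega> \<mu> h =
    (\<Sum>c\<in>h ` \<Omega>. \<Sum>d\<in>g ` \<Omega>. c * \<mu> ((h -` {c} \<inter> \<Omega>) \<inter> (g -` {d} \<inter> \<Omega>)))"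
  unfolding step_integral_def sum_distrib_left[symmetric]
  using simple_function_level_sets(2)[OF h]
  by (intro sum.cong arg_cong2[where f = "(*)"] ba_sum_level_sets[OF assms(1) g]) auto

text \<open>On each cell of the common refinement \<open>h\<close> and \<open>g\<close> are
  constants \<open>c\<close> and \<open>d\<close>. Either the cell is null and carries no mass, or
  the almost everywhere bound holds at one of its points, so that it holds for \<open>c\<close> and
  \<open>d\<close>. The masses of the cells add up to 1.\<close>

lemma step_integral_diff_le:
  assumes "\<Omega> \<in> sets borel" "\<mu> \<in> fa_prob \<Omega>"
    and h: "simple_function (restrict_space borel \<Omega>) h"
    and g: "simple_function (restrict_space borel \<Omega>) g"
    and AE: "AE x in lebesgue_on \<Omega>. \<bar>h x - g x\<bar> \<le> \<epsilon>"
  shows "\<bar>step_integral \<Omega> \<mu> h - step_integral \<Omega> \<mu> g\<bar> \<le> \<epsilon>"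
proof -
  note \<mu> = fa_probD[OF assms(2)]
  let ?A = "\<lambda>c d. (h -` {c} \<inter> \<Omega>) \<inter> (g -` {d} \<inter> \<Omega>)"
  have A: "?A c d \<in> borel_subsets \<Omega>" if "c \<in> h ` \<Omega>" "d \<in> g ` \<Omega>" for c d
    using simple_function_level_sets(2)[OF h that(1)] simple_function_level_sets(2)[OF g that(2)]
    by (rule sets.Int)
  have le: "\<bar>(c - d) * \<mu> (?A c d)\<bar> \<le> \<epsilon> * \<mu> (?A c d)" if cd: "c \<in> h ` \<Omega>" "d \<in> g ` \<Omega>" for c d
  proof (cases "?A c d \<in> null_sets lborel")
    case True
    then have "\<mu> (?A c d) = 0"
      using \<mu>(1) A[OF cd] by (auto simp: ba_def)
    then show ?thesis by simp
  next
    case False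
    then obtain x where "x \<in> ?A c d" "\<bar>h x - g x\<bar> \<le> \<epsilon>"
      using borel_subsets_AE[OF assms(1) A[OF cd] _ AE] by blast
    then have "\<bar>c - d\<bar> \<le> \<epsilon>"
      by auto
    moreover have "0 \<le> \<mu> (?A c d)"
      using \<mu>(2) A[OF cd] by (auto simp: nonneg_def)
    ultimately show ?thesis
      by (simp add: abs_mult mult_right_mono)
  qed
  \<comment> \<open>Refining \<open>g\<close> by \<open>h\<close> yields the same cells in the other
    order of summation.\<close>
  have "step_integral \<Omega> \<mu> g = (\<Sum>c\<in>h ` \<Omega>. \<Sum>d\<in>g ` \<Omega>. d * \<mu> (?A c d))"
    unfolding step_integral_refine[OF \<mu>(1) g h]
    by (subst sum.swap) (simp add: Int_commute)
  then have "step_integral \<Omega> \<mu> h - step_integral \<Omega> \<mu> g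
      = (\<Sum>c\<in>h ` \<Omega>. \<Sum>d\<in>g ` \<Omega>. (c - d) * \<mu> (?A c d))"
    unfolding step_integral_refine[OF \<mu>(1) h g]
    by (simp add: sum_subtractf left_diff_distrib)
  also have "\<bar>\<dots>\<bar> \<le> (\<Sum>c\<in>h ` \<Omega>. \<Sum>d\<in>g ` \<Omega>. \<epsilon> * \<mu> (?A c d))"
    by (intro order_trans[OF sum_abs] sum_mono le)
  also have "\<dots> = \<epsilon> * (\<Sum>c\<in>h ` \<Omega>. \<mu> (h -` {c} \<inter> \<Omega>))"
    unfolding sum_distrib_left[symmetric]
    using simple_function_level_sets(2)[OF h]
    by (intro arg_cong2[where f = "(*)"] sum.cong ba_sum_level_sets[OF \<mu>(1) g, symmetric]) auto
  also have "(\<Sum>c\<in>h ` \<Omega>. \<mu> (h -` {c} \<inter> \<Omega>)) = 1"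
    using ba_sum_level_sets[OF \<mu>(1) h, of \<Omega>] \<mu>(3) borel_subsets_iff[OF assms(1)] assms(1)
    by (simp add: Int_absorb1)
  finally show ?thesis by simp
qed

section \<open>The integral of an essentially bounded function\<close>

text \<open>A Borel version of \<open>f\<close> is truncated to the essential bound and rounded down
  to multiples of \<open>\<epsilon>\<close>; boundedness leaves finitely many values, and rounding
  costs at most \<open>\<epsilon>\<close>.\<close>

lemma Linf_simple_approx:
  assumes "\<Omega> \<in> sets borel" "f \<in> Linf \<Omega>" "0 < \<epsilon>"
  obtains h where "simple_function (restrict_space borel \<Omega>) h"
    "AE x in lebesgue_on \<Omega>. \<bar>h x - f x\<bar> \<le> \<epsilon>"
proof -
  obtain K where f: "f \<in> borel_measurable (lebesgue_on \<Omega>)"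
    and K: "AE x in lebesgue_on \<Omega>. \<bar>f x\<bar> \<le> K"
    using assms(2) by (auto simp: Linf_def)
  have \<Omega>: "\<Omega> \<in> sets lebesgue"
    using assms(1) by auto
  obtain g where g: "g \<in> borel_measurable borel"
    and fg: "AE x in lborel. (if x \<in> \<Omega> then f x else 0) = g x"
    using completion_ex_borel_measurable_real[of "\<lambda>x. if x \<in> \<Omega> then f x else 0" lborel]
      borel_measurable_if_I[OF f \<Omega>] by auto
  \<comment> \<open>The truncation makes the range of \<open>h\<close> finite at every point of
    \<open>\<Omega>\<close>, exceptional ones included; where \<open>f\<close> and \<open>g\<close>
    agree and the bound \<open>K\<close> holds, it changes nothing.\<close>
  define h where "h x = \<epsilon> * of_int \<lfloor>max (-K) (min K (g x)) / \<epsilon>\<rfloor>" for x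
  have "finite (h ` \<Omega>)"
  proof (rule finite_subset)
    \<comment> \<open>The range is stated with the absolute value because \<open>K\<close> may be
      negative when \<open>\<Omega>\<close> is a null set.\<close>
    show "h ` \<Omega> \<subseteq> (\<lambda>i. \<epsilon> * of_int i) ` {\<lfloor>- \<bar>K\<bar> / \<epsilon>\<rfloor>..\<lfloor>\<bar>K\<bar> / \<epsilon>\<rfloor>}"
    proof (rule image_subsetI)
      fix x
      have "- \<bar>K\<bar> / \<epsilon> \<le> max (-K) (min K (g x)) / \<epsilon>" "max (-K) (min K (g x)) / \<epsilon> \<le> \<bar>K\<bar> / \<epsilon>"
        using assms(3) by (intro divide_right_mono; linarith)+
      then show "h x \<in> (\<lambda>i. \<epsilon> * of_int i) ` {\<lfloor>- \<bar>K\<bar> / \<epsilon>\<rfloor>..\<lfloor>\<bar>K\<bar> / \<epsilon>\<rfloor>}"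
        unfolding h_def by (intro imageI) (simp add: floor_mono del: divide_minus_left minus_divide_left)
    qed
  qed simp
  moreover have "h \<in> borel_measurable borel"
    using g unfolding h_def by measurable
  then have "h \<in> borel_measurable (restrict_space borel \<Omega>)"
    by (rule measurable_restrict_space1)
  ultimately have "simple_function (restrict_space borel \<Omega>) h"
    by (subst simple_function_iff_borel_measurable) (auto simp: space_restrict_space)
  moreover have "AE x in lebesgue_on \<Omega>. \<bar>h x - f x\<bar> \<le> \<epsilon>"
  proof -
    have "AE x in lebesgue_on \<Omega>. f x = g x"
      using fg \<Omega> by (subst AE_restrict_space_iff) (auto simp: AE_completion_iff elim!: eventually_mono)
    with K show ?thesis
    proof eventually_elim
      case (elim x)
      then have "max (-K) (min K (g x)) = f x"
        by auto
      moreover have "\<bar>of_int \<lfloor>f x / \<epsilon>\<rfloor> - f x / \<epsilon>\<bar> \<le> 1"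
        by linarith
      then have "\<epsilon> * \<bar>of_int \<lfloor>f x / \<epsilon>\<rfloor> - f x / \<epsilon>\<bar> \<le> \<epsilon> * 1"
        using assms(3) by (intro mult_left_mono) auto
      then have "\<bar>\<epsilon> * (of_int \<lfloor>f x / \<epsilon>\<rfloor> - f x / \<epsilon>)\<bar> \<le> \<epsilon>"
        using assms(3) by (simp add: abs_mult)
      ultimately show ?case
        using assms(3) by (simp add: h_def right_diff_distrib)
    qed
  qed
  ultimately show ?thesis
    using that by blast
qed

text \<open>The approximating sequence behind \<open>I\<close> is eventually within
  \<open>\<epsilon> + e\<close> of \<open>h\<close>, and \<open>step_integral_diff_le\<close> passes
  to the limit. The bound does not depend on \<open>\<mu>\<close>, which later gives uniform
  convergence over \<open>fa_prob \<Omega>\<close>.\<close>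

lemma has_ba_integral_approx:
  assumes "\<Omega> \<in> sets borel" "\<mu> \<in> fa_prob \<Omega>" "has_ba_integral \<Omega> \<mu> f I"
    and h: "simple_function (restrict_space borel \<Omega>) h"
    and AE: "AE x in lebesgue_on \<Omega>. \<bar>h x - f x\<bar> \<le> \<epsilon>"
  shows "\<bar>I - step_integral \<Omega> \<mu> h\<bar> \<le> \<epsilon>"
proof (rule field_le_epsilon)
  fix e :: real assume e: "0 < e"
  obtain g where g: "\<And>k. simple_function (restrict_space borel \<Omega>) (g k)"
    and gf: "\<And>\<epsilon>. \<epsilon> > 0 \<Longrightarrow> \<forall>\<^sub>F k in sequentially. AE x in lebesgue_on \<Omega>. \<bar>g k x - f x\<bar> \<le> \<epsilon>"
    and lim: "(\<lambda>k. step_integral \<Omega> \<mu> (g k)) \<longlonglongrightarrow> I"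
    using assms(3) unfolding has_ba_integral_def by blast
  have "\<forall>\<^sub>F k in sequentially. \<bar>step_integral \<Omega> \<mu> (g k) - step_integral \<Omega> \<mu> h\<bar> \<le> \<epsilon> + e"
    using gf[OF e]
  proof eventually_elim
    case (elim k)
    from AE elim have "AE x in lebesgue_on \<Omega>. \<bar>g k x - h x\<bar> \<le> \<epsilon> + e"
      by eventually_elim linarith
    then show ?case
      by (rule step_integral_diff_le[OF assms(1,2) g h])
  qed
  moreover have "(\<lambda>k. \<bar>step_integral \<Omega> \<mu> (g k) - step_integral \<Omega> \<mu> h\<bar>)
      \<longlonglongrightarrow> \<bar>I - step_integral \<Omega> \<mu> h\<bar>"
    by (intro tendsto_intros lim)
  ultimately show "\<bar>I - step_integral \<Omega> \<mu> h\<bar> \<le> \<epsilon> + e"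
    using tendsto_upperbound by force
qed

lemma has_ba_integral_unique:
  assumes "\<Omega> \<in> sets borel" "f \<in> Linf \<Omega>" "\<mu> \<in> fa_prob \<Omega>"
    and "has_ba_integral \<Omega> \<mu> f I" "has_ba_integral \<Omega> \<mu> f J"
  shows "I = J"
proof -
  have "\<bar>I - J\<bar> \<le> 0 + e" if e: "0 < e" for e
  proof -
    obtain h where h: "simple_function (restrict_space borel \<Omega>) h"
      "AE x in lebesgue_on \<Omega>. \<bar>h x - f x\<bar> \<le> e / 2"
      using Linf_simple_approx[OF assms(1,2), of "e / 2"] e by auto
    show ?thesis
      using has_ba_integral_approx[OF assms(1,3,4) h] has_ba_integral_approx[OF assms(1,3,5) h]
      by linarith
  qed
  then have "\<bar>I - J\<bar> \<le> 0"
    by (rule field_le_epsilon)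
  then show ?thesis by simp
qed

text \<open>Step integrals of uniform approximations form a Cauchy sequence; with uniqueness, its
  limit makes the definite description in \<open>ba_integral\<close> meaningful.\<close>

lemma has_ba_integral_ba_integral:
  assumes "\<Omega> \<in> sets borel" "f \<in> Linf \<Omega>" "\<mu> \<in> fa_prob \<Omega>"
  shows "has_ba_integral \<Omega> \<mu> f (ba_integral \<Omega> \<mu> f)"
proof -
  have "\<exists>h. simple_function (restrict_space borel \<Omega>) h \<and>
      (AE x in lebesgue_on \<Omega>. \<bar>h x - f x\<bar> \<le> inverse (real (Suc k)))" for k
    by (rule Linf_simple_approx[OF assms(1,2), of "inverse (real (Suc k))"]) auto
  then obtain h where h: "\<And>k. simple_function (restrict_space borel \<Omega>) (h k)"
    and hf: "\<And>k. AE x in lebesgue_on \<Omega>. \<bar>h k x - f x\<bar> \<le> inverse (real (Suc k))"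
    by metis
  have small: "\<forall>\<^sub>F k in sequentially. inverse (real (Suc k)) < \<epsilon>" if "\<epsilon> > 0" for \<epsilon>
    using order_tendstoD(2)[OF LIMSEQ_inverse_real_of_nat that] .
  have hf': "\<forall>\<^sub>F k in sequentially. AE x in lebesgue_on \<Omega>. \<bar>h k x - f x\<bar> \<le> \<epsilon>" if "\<epsilon> > 0" for \<epsilon>
    using small[OF that]
  proof eventually_elim
    case (elim k)
    show ?case
      using hf[of k] by eventually_elim (use elim in linarith)
  qed
  have "Cauchy (\<lambda>k. step_integral \<Omega> \<mu> (h k))"
    unfolding Cauchy_def
  proof (intro allI impI)
    fix e :: real assume "e > 0"
    then obtain N where N: "\<And>k. k \<ge> N \<Longrightarrow> inverse (real (Suc k)) < e / 2"
      using small[of "e / 2"] by (auto simp: eventually_sequentially)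
    have "dist (step_integral \<Omega> \<mu> (h m)) (step_integral \<Omega> \<mu> (h n)) < e" if "m \<ge> N" "n \<ge> N" for m n
    proof -
      have "AE x in lebesgue_on \<Omega>. \<bar>h m x - h n x\<bar> \<le> inverse (real (Suc m)) + inverse (real (Suc n))"
        using hf[of m] hf[of n] by eventually_elim linarith
      from step_integral_diff_le[OF assms(1,3) h h this] N[OF that(1)] N[OF that(2)] show ?thesis
        by (simp add: dist_real_def)
    qed
    then show "\<exists>M. \<forall>m\<ge>M. \<forall>n\<ge>M. dist (step_integral \<Omega> \<mu> (h m)) (step_integral \<Omega> \<mu> (h n)) < e"
      by blast
  qed
  then obtain I where "(\<lambda>k. step_integral \<Omega> \<mu> (h k)) \<longlonglongrightarrow> I"
    using Cauchy_convergent convergent_def by blast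
  then have "has_ba_integral \<Omega> \<mu> f I"
    unfolding has_ba_integral_def using h hf' by blast
  then show ?thesis
    unfolding ba_integral_def
    using has_ba_integral_unique[OF assms] by (intro theI[of "has_ba_integral \<Omega> \<mu> f" I]) auto
qed

text \<open>Continuity refers to pointwise convergence of set functions. The approximations
  \<open>h k\<close> are chosen before \<open>\<mu>\<close>; each step integral involves only
  finitely many values of \<open>\<mu>\<close>, hence is continuous, and the error is uniform in
  \<open>\<mu>\<close>.\<close>

lemma continuous_on_ba_integral:
  assumes "\<Omega> \<in> sets borel" "f \<in> Linf \<Omega>"
  shows "continuous_on (fa_prob \<Omega>) (\<lambda>\<mu>. ba_integral \<Omega> \<mu> f)"
proof -
  have "\<exists>h. simple_function (restrict_space borel \<Omega>) h \<and>
      (AE x in lebesgue_on \<Omega>. \<bar>h x - f x\<bar> \<le> inverse (real (Suc k)))" for k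
    by (rule Linf_simple_approx[OF assms, of "inverse (real (Suc k))"]) auto
  then obtain h where h: "\<And>k. simple_function (restrict_space borel \<Omega>) (h k)"
    and hf: "\<And>k. AE x in lebesgue_on \<Omega>. \<bar>h k x - f x\<bar> \<le> inverse (real (Suc k))"
    by metis
  show ?thesis
  proof (rule uniform_limit_theorem)
    show "\<forall>\<^sub>F k in sequentially. continuous_on (fa_prob \<Omega>) (\<lambda>\<mu>. step_integral \<Omega> \<mu> (h k))"
      unfolding step_integral_def
      by (intro always_eventually allI continuous_intros
          continuous_on_subset[OF continuous_on_product_coordinates]) auto
    show "uniform_limit (fa_prob \<Omega>) (\<lambda>k \<mu>. step_integral \<Omega> \<mu> (h k))
        (\<lambda>\<mu>. ba_integral \<Omega> \<mu> f) sequentially"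
    proof (rule uniform_limitI)
      fix e :: real assume "e > 0"
      from order_tendstoD(2)[OF LIMSEQ_inverse_real_of_nat this]
      show "\<forall>\<^sub>F k in sequentially. \<forall>\<mu>\<in>fa_prob \<Omega>.
          dist (step_integral \<Omega> \<mu> (h k)) (ba_integral \<Omega> \<mu> f) < e"
      proof eventually_elim
        case (elim k)
        show ?case
        proof
          fix \<mu> assume \<mu>: "\<mu> \<in> fa_prob \<Omega>"
          show "dist (step_integral \<Omega> \<mu> (h k)) (ba_integral \<Omega> \<mu> f) < e"
            using has_ba_integral_approx[OF assms(1) \<mu> has_ba_integral_ba_integral[OF assms \<mu>] h hf, of k]
              elim by (simp add: dist_real_def abs_minus_commute)
        qed
      qed
    qed
  qed simp
qed

section \<open>Compactness, pointwise and weak*\<close>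

text \<open>Monotonicity turns the existential bound of \<open>ba\<close> into the fixed bound 1.
  Every remaining condition is then an equation or a weak inequality between finitely many
  coordinates, which is what closedness needs.\<close>

lemma fa_prob_iff:
  assumes "\<Omega> \<in> sets borel"
  shows "\<mu> \<in> fa_prob \<Omega> \<longleftrightarrow>
    (\<forall>A. A \<notin> borel_subsets \<Omega> \<longrightarrow> \<mu> A = 0) \<and>
    (\<forall>A\<in>borel_subsets \<Omega>. 0 \<le> \<mu> A \<and> \<mu> A \<le> 1) \<and>
    (\<forall>A\<in>borel_subsets \<Omega>. \<forall>B\<in>borel_subsets \<Omega>. A \<inter> B = {} \<longrightarrow> \<mu> (A \<union> B) = \<mu> A + \<mu> B) \<and>
    (\<forall>A\<in>borel_subsets \<Omega>. A \<in> null_sets lborel \<longrightarrow> \<mu> A = 0) \<and> \<mu> \<Omega> = 1"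
    (is "_ \<longleftrightarrow> ?R")
proof
  assume \<mu>: "\<mu> \<in> fa_prob \<Omega>"
  have "\<mu> A \<le> 1" if "A \<in> borel_subsets \<Omega>" for A
    using ba_mono[OF fa_probD(1,2)[OF \<mu>] that, of \<Omega>] that fa_probD(3)[OF \<mu>] assms
    by (simp add: borel_subsets_iff)
  then show ?R
    using \<mu> by (simp add: fa_prob_def ba_def nonneg_def)
next
  assume ?R
  then show "\<mu> \<in> fa_prob \<Omega>"
    unfolding fa_prob_def ba_def nonneg_def by (auto intro!: exI[of _ 1])
qed

lemma ba_convex_fa_prob:
  assumes "\<Omega> \<in> sets borel"
  shows "ba_convex (fa_prob \<Omega>)"
  unfolding ba_convex_def
proof (intro ballI)
  fix \<mu> \<nu> and t :: real
  assume \<mu>: "\<mu> \<in> fa_prob \<Omega>" and \<nu>: "\<nu> \<in> fa_prob \<Omega>" and t: "t \<in> {0..1}"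
  show "(\<lambda>A. (1 - t) * \<mu> A + t * \<nu> A) \<in> fa_prob \<Omega>"
    unfolding fa_prob_iff[OF assms]
  proof (intro conjI allI ballI impI)
    fix A B assume AB: "A \<in> borel_subsets \<Omega>" "B \<in> borel_subsets \<Omega>" "A \<inter> B = {}"
    have "\<mu> (A \<union> B) = \<mu> A + \<mu> B" "\<nu> (A \<union> B) = \<nu> A + \<nu> B"
      using ba_additive[OF _ AB] fa_probD(1) \<mu> \<nu> by blast+
    then show "(1 - t) * \<mu> (A \<union> B) + t * \<nu> (A \<union> B) = (1 - t) * \<mu> A + t * \<nu> A + ((1 - t) * \<mu> B + t * \<nu> B)"
      by (simp add: algebra_simps)
  qed (use \<mu> \<nu> t in \<open>auto simp: fa_prob_iff[OF assms] intro!: convex_bound_le\<close>)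
qed

lemma closed_fa_prob:
  assumes "\<Omega> \<in> sets borel"
  shows "closed (fa_prob \<Omega>)"
proof -
  have c: "continuous_on UNIV (\<lambda>\<mu>. \<mu> A)" for A :: "'a set" 
    by simp
  have "fa_prob \<Omega> =
      (\<Inter>A\<in>-borel_subsets \<Omega>. {\<mu>. \<mu> A = 0}) \<inter>
      (\<Inter>A\<in>borel_subsets \<Omega>. {\<mu>. 0 \<le> \<mu> A} \<inter> {\<mu>. \<mu> A \<le> 1}) \<inter>
      (\<Inter>A\<in>borel_subsets \<Omega>. \<Inter>B\<in>{B \<in> borel_subsets \<Omega>. A \<inter> B = {}}. {\<mu>. \<mu> (A \<union> B) = \<mu> A + \<mu> B}) \<inter>
      (\<Inter>A\<in>borel_subsets \<Omega> \<inter> null_sets lborel. {\<mu>. \<mu> A = 0}) \<inter> {\<mu>. \<mu> \<Omega> = 1}"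
    using fa_prob_iff[OF assms] by auto
  also have "closed \<dots>"
    by (intro closed_Int closed_INT ballI closed_Collect_eq closed_Collect_le continuous_intros c)
  finally show ?thesis .
qed

text \<open>A closed subset of a cube that is compact by Tychonoff's theorem; the coordinates
  outside \<open>borel_subsets \<Omega>\<close> are 0 and thus also lie in the unit
  interval.\<close>

lemma compact_fa_prob:
  assumes "\<Omega> \<in> sets borel"
  shows "compact (fa_prob \<Omega>)"
proof -
  have "compactin (product_topology (\<lambda>_. euclideanreal) UNIV) (PiE UNIV (\<lambda>_::'a set. {0..1}))"
    by (subst compactin_PiE) auto
  then have "compact (PiE UNIV (\<lambda>_::'a set. {0..1::real}))"
    by (simp add: euclidean_product_topology)
  moreover have "fa_prob \<Omega> \<subseteq> PiE UNIV (\<lambda>_. {0..1})"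
    unfolding subset_iff fa_prob_iff[OF assms] by (auto simp: PiE_iff)
  ultimately show ?thesis
    using closed_fa_prob[OF assms] by (metis compact_Int_closed inf.absorb2)
qed

text \<open>The weak* topology is pulled back along the evaluations, so continuity of the identity
  reduces to continuity of each integral. Compact sets and cluster points are transferred through
  this map.\<close>

lemma continuous_map_weakstar:
  assumes "\<Omega> \<in> sets borel"
  shows "continuous_map (top_of_set (fa_prob \<Omega>)) (weakstar \<Omega>) (\<lambda>\<mu>. \<mu>)"
  unfolding weakstar_def
proof (rule continuous_map_pullback')
  show "continuous_map (top_of_set (fa_prob \<Omega>)) (product_topology (\<lambda>_. euclideanreal) (Linf \<Omega>))
      ((\<lambda>\<mu>. \<lambda>f\<in>Linf \<Omega>. ba_integral \<Omega> \<mu> f) \<circ> (\<lambda>\<mu>. \<mu>))"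
    using continuous_on_ba_integral[OF assms]
    by (auto simp: continuous_map_componentwise o_def)
qed (auto simp: fa_prob_def)

lemma compactin_weakstar:
  assumes "\<Omega> \<in> sets borel" "compact S" "S \<subseteq> fa_prob \<Omega>"
  shows "compactin (weakstar \<Omega>) S"
  using image_compactin[OF _ continuous_map_weakstar[OF assms(1)], of S] assms(2,3)
  by (simp add: compactin_subtopology)

section \<open>Cores\<close>

lemma open_vimage_Some:
  assumes "openin compactified U"
  shows "open (Some -` U)"
  using openin_continuous_map_preimage[OF continuous_map_Some assms] by (simp add: vimage_def)

lemma vimage_Some_in_borel_subsets:
  assumes "\<Omega> \<in> sets borel" "openin compactified U"
  shows "Some -` U \<inter> \<Omega> \<in> borel_subsets \<Omega>"
  using assms open_vimage_Some[OF assms(2)] by (auto simp: borel_subsets_iff)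

lemma core_fa_prob_iff:
  assumes "\<Omega> \<in> sets borel" "\<mu> \<in> fa_prob \<Omega>"
  shows "x \<in> core \<Omega> \<mu> \<longleftrightarrow> (\<forall>U. openin compactified U \<and> x \<in> U \<longrightarrow> \<mu> (Some -` U \<inter> \<Omega>) \<noteq> 0)"
proof -
  have "total_variation \<Omega> \<mu> (Some -` U \<inter> \<Omega>) = \<mu> (Some -` U \<inter> \<Omega>)" "0 \<le> \<mu> (Some -` U \<inter> \<Omega>)"
    if "openin compactified U" for U
    using total_variation_nonneg[OF fa_probD(1,2)[OF assms(2)]] fa_probD(2)[OF assms(2)]
      vimage_Some_in_borel_subsets[OF assms(1) that] by (auto simp: nonneg_def)
  then show ?thesis
    unfolding core_def by (smt (verit, best) mem_Collect_eq)
qed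

text \<open>The sets may overlap, so only the part of the union outside \<open>A\<close> is added to
  \<open>A\<close>; by monotonicity it is null as well.\<close>

lemma ba_null_Union:
  assumes \<mu>: "\<mu> \<in> ba \<Omega>" "nonneg \<Omega> \<mu>" and "finite \<F>" "\<And>A. A \<in> \<F> \<Longrightarrow> A \<in> borel_subsets \<Omega> \<and> \<mu> A = 0"
  shows "\<mu> (\<Union>\<F>) = 0"
  using assms(3,4)
proof (induction \<F>)
  case empty
  then show ?case using ba_empty[OF \<mu>(1)] by simp
next
  case (insert A \<F>)
  have U: "\<Union>\<F> \<in> borel_subsets \<Omega>" "A \<in> borel_subsets \<Omega>"
    using insert by auto
  have "\<mu> (A \<union> (\<Union>\<F> - A)) = \<mu> A + \<mu> (\<Union>\<F> - A)"
    using U by (intro ba_additive[OF \<mu>(1)]) auto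
  moreover have "\<mu> (\<Union>\<F> - A) \<le> \<mu> (\<Union>\<F>)" "0 \<le> \<mu> (\<Union>\<F> - A)"
    using ba_mono[OF \<mu>, of "\<Union>\<F> - A" "\<Union>\<F>"] \<mu>(2) U by (auto simp: nonneg_def)
  ultimately show ?case
    using insert by simp
qed

text \<open>Every point outside \<open>V\<close>, possibly \<open>\<infinity>\<close>, is outside
  the core and has an open neighborhood of mass 0. The complement of \<open>V\<close> is compact
  because the compactification is, so finitely many of these neighborhoods cover it, and finite
  additivity suffices to make it null.\<close>

lemma core_subset_openin_imp:
  assumes "\<Omega> \<in> sets borel" "\<mu> \<in> fa_prob \<Omega>" "openin compactified V" "core \<Omega> \<mu> \<subseteq> V"
  shows "\<mu> (Some -` V \<inter> \<Omega>) = 1"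
proof -
  note \<mu> = fa_probD[OF assms(2)]
  let ?K = "topspace compactified - V"
  let ?\<U> = "{U. openin compactified U \<and> \<mu> (Some -` U \<inter> \<Omega>) = 0}"
  have "compactin compactified ?K"
    by (rule closedin_compact_space[OF _ closedin_diff[OF closedin_topspace assms(3)]]) simp
  moreover have "?K \<subseteq> \<Union>?\<U>"
    using core_fa_prob_iff[OF assms(1,2)] assms(4) by blast
  ultimately obtain \<F> where \<F>: "finite \<F>" "\<F> \<subseteq> ?\<U>" "?K \<subseteq> \<Union>\<F>"
    unfolding compactin_def by (metis (no_types, lifting) mem_Collect_eq)
  define N where "N = \<Union>((\<lambda>U. Some -` U \<inter> \<Omega>) ` \<F>)"
  have N: "N \<in> borel_subsets \<Omega>" "\<mu> N = 0"
  proof -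
    have null: "A \<in> borel_subsets \<Omega> \<and> \<mu> A = 0" if "A \<in> (\<lambda>U. Some -` U \<inter> \<Omega>) ` \<F>" for A
      using that \<F>(2) vimage_Some_in_borel_subsets[OF assms(1)] by blast
    show "N \<in> borel_subsets \<Omega>"
      unfolding N_def
    proof (rule sets.finite_Union)
      show "finite ((\<lambda>U. Some -` U \<inter> \<Omega>) ` \<F>)"
        using \<F>(1) by (rule finite_imageI)
      show "(\<lambda>U. Some -` U \<inter> \<Omega>) ` \<F> \<subseteq> borel_subsets \<Omega>"
        using null by (intro subsetI) simp
    qed
    show "\<mu> N = 0"
      unfolding N_def by (rule ba_null_Union[OF \<mu>(1,2) finite_imageI[OF \<F>(1)] null])
  qed
  have V: "Some -` V \<inter> \<Omega> \<in> borel_subsets \<Omega>"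
    using vimage_Some_in_borel_subsets[OF assms(1,3)] .
  have sub: "\<Omega> - Some -` V \<subseteq> N"
  proof
    fix y assume y: "y \<in> \<Omega> - Some -` V"
    then have "Some y \<in> ?K"
      by simp
    then obtain U where "U \<in> \<F>" "Some y \<in> U"
      using \<F>(3) by blast
    then show "y \<in> N"
      unfolding N_def using y by blast
  qed
  have \<Omega>: "\<Omega> \<in> borel_subsets \<Omega>"
    using assms(1) borel_subsets_iff by blast
  have D: "\<Omega> - Some -` V \<in> borel_subsets \<Omega>"
    using sets.Diff[OF \<Omega> V] by (simp add: Diff_Int)
  have "\<mu> (\<Omega> - Some -` V) = 0"
    using ba_mono[OF \<mu>(1,2) D N(1) sub] N(2) \<mu>(2) D by (auto simp: nonneg_def)
  moreover have "\<mu> ((Some -` V \<inter> \<Omega>) \<union> (\<Omega> - Some -` V)) = \<mu> (Some -` V \<inter> \<Omega>) + \<mu> (\<Omega> - Some -` V)"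
    by (intro ba_additive[OF \<mu>(1) V D]) auto
  moreover have "(Some -` V \<inter> \<Omega>) \<union> (\<Omega> - Some -` V) = \<Omega>"
    by auto
  ultimately show ?thesis
    using \<mu>(3) by simp
qed

lemma nhd_image_Some: "nhd \<delta> (Some ` C) = Some ` (\<Union>x\<in>C. ball x \<delta>)"
  by (auto simp: nhd_def)

lemma vimage_Some_nhd: "Some -` nhd \<delta> (Some ` C) = (\<Union>x\<in>C. ball x \<delta>)"
  by (auto simp: nhd_image_Some)

lemma openin_nhd: "openin compactified (nhd \<delta> (Some ` C))"
  by (auto simp: nhd_image_Some)

text \<open>The trace of \<open>U\<close> is disjoint from a neighborhood of \<open>C\<close> that
  already carries the whole mass 1.\<close>

lemma concentrated_imp_not_in_core:
  assumes "\<Omega> \<in> sets borel" "\<mu> \<in> fa_prob \<Omega>" "concentrated_at \<Omega> (Some ` C) \<mu>"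
    and "openin compactified U" "x \<in> U" "0 < \<delta>" "Some -` U \<inter> (\<Union>x\<in>C. ball x \<delta>) = {}"
  shows "x \<notin> core \<Omega> \<mu>"
proof -
  note \<mu> = fa_probD[OF assms(2)]
  let ?A = "Some -` U \<inter> \<Omega>" and ?B = "Some -` nhd \<delta> (Some ` C) \<inter> \<Omega>"
  have AB: "?A \<in> borel_subsets \<Omega>" "?B \<in> borel_subsets \<Omega>"
    using vimage_Some_in_borel_subsets[OF assms(1)] assms(4) openin_nhd by blast+
  moreover have "?A \<inter> ?B = {}"
    using assms(7) unfolding vimage_Some_nhd by blast
  ultimately have "\<mu> (?A \<union> ?B) = \<mu> ?A + \<mu> ?B"
    by (rule ba_additive[OF \<mu>(1)])
  moreover have "\<mu> (?A \<union> ?B) \<le> 1" "0 \<le> \<mu> ?A"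
    using AB assms(2) by (auto simp: fa_prob_iff[OF assms(1)])
  moreover have "\<mu> ?B = 1"
    using assms(3,6) \<mu>(3) by (auto simp: concentrated_at_def)
  ultimately have "\<mu> ?A = 0"
    by linarith
  then show ?thesis
    using core_fa_prob_iff[OF assms(1,2)] assms(4,5) by blast
qed

text \<open>A point outside the closure is separated from a whole
  \<open>\<delta>\<close>-neighborhood of \<open>C\<close>: a finite point by halving a radius, the
  point \<open>\<infinity>\<close> because \<open>C\<close> is then contained in a compact
  set.\<close>

lemma core_subset_closure_of:
  assumes "\<Omega> \<in> sets borel" "\<mu> \<in> fa_prob \<Omega>" "closed C" "concentrated_at \<Omega> (Some ` C) \<mu>"
  shows "core \<Omega> \<mu> \<subseteq> compactified closure_of (Some ` C)"
proof
  fix x assume x: "x \<in> core \<Omega> \<mu>"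
  show "x \<in> compactified closure_of (Some ` C)"
  proof (rule ccontr)
    assume notin: "x \<notin> compactified closure_of (Some ` C)"
    show False
    proof (cases x)
      case (Some y)
      have "Some ` C \<subseteq> compactified closure_of (Some ` C)"
        by (rule closure_of_subset) auto
      then have "y \<notin> C"
        using notin Some by blast
      then obtain e where e: "0 < e" "ball y e \<subseteq> -C"
        using assms(3) by (metis ComplI open_Compl openE)
      have "Some -` (Some ` ball y (e / 2)) \<inter> (\<Union>x\<in>C. ball x (e / 2)) = {}"
      proof (rule ccontr)
        assume "Some -` (Some ` ball y (e / 2)) \<inter> (\<Union>x\<in>C. ball x (e / 2)) \<noteq> {}"
        then obtain z c where "z \<in> ball y (e / 2)" "c \<in> C" "z \<in> ball c (e / 2)"
          by auto
        then have "c \<in> ball y e"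
          using dist_triangle_half_l[of y z e c] by (simp add: dist_commute)
        then show False
          using e(2) \<open>c \<in> C\<close> by blast
      qed
      then show False
        using concentrated_imp_not_in_core[OF assms(1,2,4), of "Some ` ball y (e / 2)" x "e / 2"]
          x e(1) Some by auto
    next
      case None
      then obtain T where T: "openin compactified T" "None \<in> T" "T \<inter> Some ` C = {}"
        using notin by (auto simp: closure_of_def)
      then obtain K where K: "compact K" "T = insert None (Some ` (- K))"
        by (auto simp: openin_Alexandroff_compactification Compl_eq_Diff_UNIV)
      \<comment> \<open>The neighborhood of \<open>\<infinity>\<close> given by \<open>K\<close>
        avoids \<open>C\<close> only. Enlarging \<open>K\<close> by the closed unit ball keeps it
        compact and absorbs the neighborhood of \<open>C\<close> of radius 1, the value of
        \<open>\<delta>\<close> used below.\<close>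
      define K' where "K' = {x + y | x y. x \<in> K \<and> y \<in> cball 0 1}"
      have K': "compact K'"
        unfolding K'_def by (rule compact_sums[OF K(1) compact_cball])
      have "(\<Union>x\<in>C. ball x 1) \<subseteq> K'"
      proof
        fix z assume "z \<in> (\<Union>x\<in>C. ball x 1)"
        then obtain c where "c \<in> C" "dist c z < 1"
          by auto
        moreover from \<open>c \<in> C\<close> have "c \<in> K"
          using T(3) K(2) by blast
        moreover have "z = c + (z - c)"
          by simp
        moreover have "z - c \<in> cball 0 1"
          using \<open>dist c z < 1\<close> by (simp add: dist_norm norm_minus_commute)
        ultimately show "z \<in> K'"
          unfolding K'_def by blast
      qed
      moreover have "openin compactified (insert None (Some ` (- K')))"
        unfolding openin_Alexandroff_compactification using K'
        by (auto simp: compact_imp_closed Compl_eq_Diff_UNIV)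
      ultimately show False
        using concentrated_imp_not_in_core[OF assms(1,2,4), of "insert None (Some ` (- K'))" x 1]
          x None by auto
    qed
  qed
qed

text \<open>If \<open>x\<close> is in neither core, the intersection of a \<open>\<mu>\<close>-null
  and a \<open>\<nu>\<close>-null neighborhood of \<open>x\<close> is null for the
  combination.\<close>

lemma core_convex_combination:
  assumes "\<Omega> \<in> sets borel" "\<mu> \<in> fa_prob \<Omega>" "\<nu> \<in> fa_prob \<Omega>" "t \<in> {0..1}"
  shows "core \<Omega> (\<lambda>A. (1 - t) * \<mu> A + t * \<nu> A) \<subseteq> core \<Omega> \<mu> \<union> core \<Omega> \<nu>"
proof (rule ccontr)
  assume "\<not> ?thesis"
  then obtain x where x: "x \<in> core \<Omega> (\<lambda>A. (1 - t) * \<mu> A + t * \<nu> A)"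
    "x \<notin> core \<Omega> \<mu>" "x \<notin> core \<Omega> \<nu>"
    by blast
  obtain U V where U: "openin compactified U" "x \<in> U" "\<mu> (Some -` U \<inter> \<Omega>) = 0"
    and V: "openin compactified V" "x \<in> V" "\<nu> (Some -` V \<inter> \<Omega>) = 0"
    using x(2,3) core_fa_prob_iff[OF assms(1)] assms(2,3) by metis
  have UV: "openin compactified (U \<inter> V)" "x \<in> U \<inter> V"
    using U V by auto
  let ?A = "Some -` (U \<inter> V) \<inter> \<Omega>"
  have A: "?A \<in> borel_subsets \<Omega>"
    by (rule vimage_Some_in_borel_subsets[OF assms(1) UV(1)])
  have "\<mu> ?A \<le> \<mu> (Some -` U \<inter> \<Omega>)" "\<nu> ?A \<le> \<nu> (Some -` V \<inter> \<Omega>)"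
    by (rule ba_mono[OF fa_probD(1,2)[OF assms(2)] A] ba_mono[OF fa_probD(1,2)[OF assms(3)] A],
        rule vimage_Some_in_borel_subsets[OF assms(1)], use U(1) V(1) in blast, blast)+
  moreover have "0 \<le> \<mu> ?A" "0 \<le> \<nu> ?A"
    using fa_probD(2) assms(2,3) A by (auto simp: nonneg_def)
  ultimately have "(1 - t) * \<mu> ?A + t * \<nu> ?A = 0"
    using U(3) V(3) by simp
  moreover have "(\<lambda>A. (1 - t) * \<mu> A + t * \<nu> A) \<in> fa_prob \<Omega>"
    using ba_convex_fa_prob[OF assms(1)] assms(2-4) by (auto simp: ba_convex_def)
  ultimately show False
    using core_fa_prob_iff[OF assms(1)] x(1) UV by blast
qed

section \<open>Density measures and the sets of part (1)\<close>

lemma concentrated_imp_fa_prob: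
  assumes "\<mu> \<in> ba \<Omega>" "nonneg \<Omega> \<mu>" "concentrated_at \<Omega> K \<mu>"
  shows "\<mu> \<in> fa_prob \<Omega>"
  using assms by (auto simp: fa_prob_def concentrated_at_def intro: zero_less_one)

lemma Dens_eq_fa_prob: "Dens \<Omega> K = {\<mu> \<in> fa_prob \<Omega>. concentrated_at \<Omega> K \<mu>}"
  using concentrated_imp_fa_prob by (fastforce simp: Dens_def fa_prob_def)

lemma concentrated_fa_prob_iff:
  assumes "\<mu> \<in> fa_prob \<Omega>"
  shows "concentrated_at \<Omega> K \<mu> \<longleftrightarrow> (\<forall>\<delta>>0. \<mu> (Some -` nhd \<delta> K \<inter> \<Omega>) = 1)"
  using fa_probD(3)[OF assms] by (auto simp: concentrated_at_def)

lemma ba_convex_Dens: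
  assumes "\<Omega> \<in> sets borel"
  shows "ba_convex (Dens \<Omega> K)"
  using ba_convex_fa_prob[OF assms] unfolding ba_convex_def Dens_eq_fa_prob
  by (simp add: concentrated_at_def)

text \<open>Each \<open>\<delta>\<close> adds a closed condition on a single coordinate, so the
  intersection with the compact set \<open>fa_prob \<Omega>\<close> is compact.\<close>

lemma compactin_Dens:
  assumes "\<Omega> \<in> sets borel"
  shows "compactin (weakstar \<Omega>) (Dens \<Omega> K)"
proof (rule compactin_weakstar[OF assms])
  have c: "continuous_on UNIV (\<lambda>\<mu>::'a set \<Rightarrow> real. \<mu> A)" for A 
    by simp
  have "Dens \<Omega> K = fa_prob \<Omega> \<inter> (\<Inter>\<delta>\<in>{0<..}. {\<mu>. \<mu> (Some -` nhd \<delta> K \<inter> \<Omega>) = 1})"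
    by (auto simp: Dens_eq_fa_prob concentrated_fa_prob_iff)
  also have "compact \<dots>"
    by (intro compact_Int_closed compact_fa_prob assms closed_INT ballI closed_Collect_eq c continuous_intros)
  finally show "compact (Dens \<Omega> K)" .
qed (auto simp: Dens_eq_fa_prob)

text \<open>Concentration at \<open>C\<close> already forces the core into the closure of
  \<open>C\<close>.\<close>

lemma M_set_closure_eq_Dens:
  assumes "\<Omega> \<in> sets borel" "closed C"
  shows "M_set_closure \<Omega> C = Dens \<Omega> (Some ` C)"
  using core_subset_closure_of[OF assms(1) concentrated_imp_fa_prob assms(2)]
  by (auto simp: M_set_closure_def Dens_def)

lemma M_set_eq_Dens:
  assumes "\<Omega> \<in> sets borel" "compact C"
  shows "M_set \<Omega> C = Dens \<Omega> (Some ` C)"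
proof -
  have "compactified closure_of (Some ` C) = Some ` C"
    using assms(2) by (simp add: closure_of_closedin compact_imp_closed)
  then have "M_set \<Omega> C = M_set_closure \<Omega> C"
    by (simp add: M_set_def M_set_closure_def)
  then show ?thesis
    using M_set_closure_eq_Dens[OF assms(1) compact_imp_closed[OF assms(2)]] by simp
qed

lemma ba_convex_M_set:
  assumes "\<Omega> \<in> sets borel"
  shows "ba_convex (M_set \<Omega> C)"
proof -
  have M: "M_set \<Omega> C = {\<mu> \<in> Dens \<Omega> (Some ` C). core \<Omega> \<mu> \<subseteq> Some ` C}"
    by (auto simp: M_set_def Dens_def)
  show ?thesis
    unfolding ba_convex_def
  proof (intro ballI)
    fix \<mu> \<nu> and t :: real
    assume \<mu>: "\<mu> \<in> M_set \<Omega> C" and \<nu>: "\<nu> \<in> M_set \<Omega> C" and t: "t \<in> {0..1}"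
    have "(\<lambda>A. (1 - t) * \<mu> A + t * \<nu> A) \<in> Dens \<Omega> (Some ` C)"
      using ba_convex_Dens[OF assms] \<mu> \<nu> t unfolding ba_convex_def M by blast
    then show "(\<lambda>A. (1 - t) * \<mu> A + t * \<nu> A) \<in> M_set \<Omega> C"
      using core_convex_combination[OF assms, of \<mu> \<nu> t] \<mu> \<nu> t
      unfolding M Dens_eq_fa_prob by auto
  qed
qed

section \<open>Cluster points and subsequences\<close>

text \<open>A compact \<open>S\<close> need not be sequentially compact, so the result is a cluster
  point, not the limit of a subsequence. If only finitely many terms were in \<open>U\<close>, the
  sequence filter would eventually leave \<open>U\<close>, and its infimum with
  \<open>nhds x\<close> would be trivial.\<close>

lemma compact_cluster_point:
  fixes s :: "nat \<Rightarrow> 'b::topological_space"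
  assumes "compact S" "\<And>k. s k \<in> S"
  obtains x where "x \<in> S" "\<And>U. open U \<Longrightarrow> x \<in> U \<Longrightarrow> infinite {k. s k \<in> U}"
proof -
  let ?F = "filtermap s sequentially"
  have "\<forall>\<^sub>F x in ?F. x \<in> S"
    using assms(2) by (simp add: eventually_filtermap)
  moreover have "?F \<noteq> bot"
    by (simp add: filtermap_bot_iff)
  ultimately have "\<exists>x\<in>S. inf (nhds x) ?F \<noteq> bot"
    using assms(1)[unfolded compact_filter, rule_format, of ?F] by simp
  then obtain x where x: "x \<in> S" "inf (nhds x) ?F \<noteq> bot"
    by blast
  have "infinite {k. s k \<in> U}" if U: "open U" "x \<in> U" for U
  proof
    assume "finite {k. s k \<in> U}"
    then have "\<forall>\<^sub>F k in sequentially. s k \<notin> U"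
      by (simp add: cofinite_eq_sequentially[symmetric] eventually_cofinite)
    then have "\<forall>\<^sub>F y in ?F. y \<notin> U"
      by (simp add: eventually_filtermap)
    moreover have "\<forall>\<^sub>F y in nhds x. y \<in> U"
      by (rule eventually_nhds_in_open[OF U])
    ultimately have "\<forall>\<^sub>F y in inf (nhds x) ?F. False"
      unfolding eventually_inf by blast
    then show False
      using x(2) by (simp add: eventually_False)
  qed
  with x(1) show ?thesis
    using that by blast
qed

lemma strict_mono_subseq_of_infinite:
  assumes "\<And>j::nat. infinite {k::nat. P j k}"
  obtains r :: "nat \<Rightarrow> nat" where "strict_mono r" "\<And>j. P j (r j)"
proof -
  have "\<exists>r. \<forall>j. P j (r j) \<and> r j < r (Suc j)"
  proof (rule dependent_nat_choice)
    show "\<exists>k. P 0 k"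
      using assms[of 0] by (auto dest: infinite_imp_nonempty)
    show "\<exists>k'. P (Suc j) k' \<and> k < k'" for j k
      using assms[of "Suc j"] unfolding infinite_nat_iff_unbounded by blast
  qed
  then show ?thesis
    using that by (auto simp: strict_mono_Suc_iff)
qed

text \<open>Part (1) reduces to \<open>Dens\<close>, apart from the convexity of
  \<open>M_set\<close>. In part (2) a cluster point for pointwise convergence is taken first; the
  cores locate its mass, and the subsequence comes from a continuous scalar function.\<close>

theorem proposition3p10:
  fixes \<Omega> :: "'a::euclidean_space set"
  assumes "\<Omega> \<in> sets borel"
  shows
    "(\<forall>C. closed C \<and> C \<subseteq> closure \<Omega> \<longrightarrow>
        ba_convex (M_set \<Omega> C) \<and>
        (bounded C \<longrightarrow> compactin (weakstar \<Omega>) (M_set \<Omega> C)) \<and>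
        ba_convex (M_set_closure \<Omega> C) \<and>
        compactin (weakstar \<Omega>) (M_set_closure \<Omega> C))
     \<and>
     (\<forall>C \<mu> \<delta>.
        C \<noteq> {} \<and> closed C \<and> C \<subseteq> closure \<Omega> \<and> C \<inter> \<Omega> \<in> null_sets lborel \<and>
        (\<forall>k::nat. \<mu> k \<in> ba \<Omega> \<and> density_measure \<Omega> (\<mu> k)) \<and>
        (\<forall>k. \<delta> k > 0) \<and> decseq \<delta> \<and> \<delta> \<longlonglongrightarrow> 0 \<and>
        (\<forall>k. core \<Omega> (\<mu> k) \<subseteq> nhd (\<delta> k) (Some ` C))
        \<longrightarrow>
        (\<exists>\<nu> \<in> Dens \<Omega> (Some ` C).
           weakstar_accumulation_point \<Omega> \<mu> \<nu> \<and>
           (\<forall>(m::nat) (f :: 'a \<Rightarrow> nat \<Rightarrow> real).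
              (\<forall>i<m. (\<lambda>x. f x i) \<in> Linf \<Omega>) \<longrightarrow>
              (\<exists>r :: nat \<Rightarrow> nat. strict_mono r \<and>
                 (\<forall>i<m. (\<lambda>k. ba_integral \<Omega> (\<mu> (r k)) (\<lambda>x. f x i))
                           \<longlonglongrightarrow> ba_integral \<Omega> \<nu> (\<lambda>x. f x i))))))"
proof (intro conjI allI impI; (elim conjE)?)
  fix C :: "'a set" assume C: "closed C"
  show "ba_convex (M_set \<Omega> C)"
    by (rule ba_convex_M_set[OF assms])
  show "ba_convex (M_set_closure \<Omega> C)" "compactin (weakstar \<Omega>) (M_set_closure \<Omega> C)"
    using ba_convex_Dens compactin_Dens assms M_set_closure_eq_Dens[OF assms C] by auto
  show "compactin (weakstar \<Omega>) (M_set \<Omega> C)" if "bounded C"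
    using compactin_Dens[OF assms] M_set_eq_Dens[OF assms] C that by (simp add: compact_eq_bounded_closed)
next
  fix C :: "'a set" and \<mu> and \<delta> :: "nat \<Rightarrow> real"
  assume C: "closed C" and \<mu>: "\<forall>k. \<mu> k \<in> ba \<Omega> \<and> density_measure \<Omega> (\<mu> k)"
    and \<delta>: "\<delta> \<longlonglongrightarrow> 0" and core: "\<forall>k. core \<Omega> (\<mu> k) \<subseteq> nhd (\<delta> k) (Some ` C)"
  \<comment> \<open>The site of \<open>\<mu> k\<close> may vary with \<open>k\<close>; it supplies
    mass one, while the location of the mass is read off the cores.\<close>
  have fa: "\<mu> k \<in> fa_prob \<Omega>" for k
    using \<mu> by (auto simp: density_measure_def Dens_eq_fa_prob)
  obtain \<nu> where \<nu>: "\<nu> \<in> fa_prob \<Omega>" and cluster: "\<And>U. open U \<Longrightarrow> \<nu> \<in> U \<Longrightarrow> infinite {k. \<mu> k \<in> U}"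
    using compact_cluster_point[OF compact_fa_prob[OF assms], of \<mu>] fa by blast
  \<comment> \<open>Relatively open sets are the form in which preimages arrive under maps known to
    be continuous only on \<open>fa_prob \<Omega>\<close>.\<close>
  have cluster': "infinite {k. \<mu> k \<in> U}" if U: "openin (top_of_set (fa_prob \<Omega>)) U" "\<nu> \<in> U" for U
  proof -
    obtain T where "open T" "U = fa_prob \<Omega> \<inter> T"
      using U(1) by (auto simp: openin_open)
    then show ?thesis
      using cluster[of T] U(2) fa by simp
  qed
  have "\<nu> (Some -` nhd \<epsilon> (Some ` C) \<inter> \<Omega>) = 1" (is "\<nu> ?A = 1") if "\<epsilon> > 0" for \<epsilon>
  proof (rule ccontr)
    assume "\<nu> ?A \<noteq> 1"
    \<comment> \<open>Mass different from 1 is an open condition on one coordinate, so it would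
      recur for infinitely many \<open>\<mu> k\<close>; but once
      \<open>\<delta> k < \<epsilon>\<close>, the core of \<open>\<mu> k\<close> lies in the open
      \<open>\<epsilon>\<close>-neighborhood, which then has mass 1.\<close>
    moreover have "open {m :: 'a set \<Rightarrow> real. m ?A \<noteq> 1}"
      by (intro open_Collect_neq continuous_intros continuous_on_product_coordinates)
    ultimately have inf: "infinite {k. \<mu> k ?A \<noteq> 1}"
      using cluster[of "{m. m ?A \<noteq> 1}"] by simp
    have "\<forall>\<^sub>F k in sequentially. \<mu> k ?A = 1"
      using order_tendstoD(2)[OF \<delta> that]
    proof eventually_elim
      case (elim k)
      have "nhd (\<delta> k) (Some ` C) \<subseteq> nhd \<epsilon> (Some ` C)"
        using elim by (fastforce simp: nhd_image_Some)
      then have "core \<Omega> (\<mu> k) \<subseteq> nhd \<epsilon> (Some ` C)"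
        using core by blast
      then show ?case
        by (rule core_subset_openin_imp[OF assms fa openin_nhd])
    qed
    then have "finite {k. \<mu> k ?A \<noteq> 1}"
      by (simp add: cofinite_eq_sequentially[symmetric] eventually_cofinite)
    with inf show False by blast
  qed
  then have "\<nu> \<in> Dens \<Omega> (Some ` C)"
    using \<nu> by (simp add: Dens_eq_fa_prob concentrated_fa_prob_iff)
  moreover have "weakstar_accumulation_point \<Omega> \<mu> \<nu>"
    unfolding weakstar_accumulation_point_def
  proof (intro conjI allI impI; (elim conjE)?)
    show "\<nu> \<in> ba \<Omega>"
      using \<nu> fa_probD by blast
    fix U assume U: "openin (weakstar \<Omega>) U" "\<nu> \<in> U"
    have "openin (top_of_set (fa_prob \<Omega>)) {m \<in> fa_prob \<Omega>. m \<in> U}"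
      using openin_continuous_map_preimage[OF continuous_map_weakstar[OF assms] U(1)] by simp
    from cluster'[OF this] show "infinite {k. \<mu> k \<in> U}"
      using U(2) \<nu> fa by simp
  qed
  moreover have "\<exists>r :: nat \<Rightarrow> nat. strict_mono r \<and>
      (\<forall>i<m. (\<lambda>k. ba_integral \<Omega> (\<mu> (r k)) (\<lambda>x. f x i)) \<longlonglongrightarrow> ba_integral \<Omega> \<nu> (\<lambda>x. f x i))"
    if f: "\<forall>i<m. (\<lambda>x. f x i) \<in> Linf \<Omega>" for m :: nat and f :: "'a \<Rightarrow> nat \<Rightarrow> real"
  proof -
    \<comment> \<open>Adding up the deviations of all \<open>m\<close> components lets one
      subsequence serve every component. Since \<open>G\<close> vanishes at \<open>\<nu>\<close>,
      each of its strict sublevel sets at a positive level is a relative neighborhood of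
      \<open>\<nu>\<close>.\<close>
    define G where
      "G \<kappa> = (\<Sum>i<m. \<bar>ba_integral \<Omega> \<kappa> (\<lambda>x. f x i) - ba_integral \<Omega> \<nu> (\<lambda>x. f x i)\<bar>)" for \<kappa>
    have G: "continuous_on (fa_prob \<Omega>) G"
      unfolding G_def using f by (intro continuous_intros continuous_on_ba_integral[OF assms]) auto
    have G_small: "infinite {k. G (\<mu> k) < inverse (real (Suc j))}" for j
    proof -
      have "openin (top_of_set (fa_prob \<Omega>)) (fa_prob \<Omega> \<inter> G -` {..<inverse (real (Suc j))})"
        by (intro continuous_openin_preimage_gen G) auto
      from cluster'[OF this] show ?thesis
        using \<nu> fa by (simp add: G_def)
    qed
    obtain r where r: "strict_mono r" "\<And>j. G (\<mu> (r j)) < inverse (real (Suc j))"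
      using strict_mono_subseq_of_infinite[of "\<lambda>j k. G (\<mu> k) < inverse (real (Suc j))", OF G_small]
      by metis
    have "(\<lambda>k. ba_integral \<Omega> (\<mu> (r k)) (\<lambda>x. f x i)) \<longlonglongrightarrow> ba_integral \<Omega> \<nu> (\<lambda>x. f x i)"
      if "i < m" for i
    proof (rule LIM_zero_cancel, rule Lim_null_comparison)
      show "\<forall>\<^sub>F k in sequentially.
          norm (ba_integral \<Omega> (\<mu> (r k)) (\<lambda>x. f x i) - ba_integral \<Omega> \<nu> (\<lambda>x. f x i)) \<le> inverse (real (Suc k))"
      proof (rule always_eventually, rule allI)
        fix k
        have "\<bar>ba_integral \<Omega> (\<mu> (r k)) (\<lambda>x. f x i) - ba_integral \<Omega> \<nu> (\<lambda>x. f x i)\<bar> \<le> G (\<mu> (r k))"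
          unfolding G_def
          by (rule member_le_sum[where f = "\<lambda>i. \<bar>ba_integral \<Omega> (\<mu> (r k)) (\<lambda>x. f x i) - ba_integral \<Omega> \<nu> (\<lambda>x. f x i)\<bar>"])
            (use that in simp_all)
        then show "norm (ba_integral \<Omega> (\<mu> (r k)) (\<lambda>x. f x i) - ba_integral \<Omega> \<nu> (\<lambda>x. f x i))
            \<le> inverse (real (Suc k))"
          using r(2)[of k] by simp
      qed
    qed (rule LIMSEQ_inverse_real_of_nat)
    with r(1) show ?thesis
      by (intro exI[of _ r] conjI allI impI)
  qed
  ultimately show "\<exists>\<nu> \<in> Dens \<Omega> (Some ` C).
           weakstar_accumulation_point \<Omega> \<mu> \<nu> \<and>
           (\<forall>(m::nat) (f :: 'a \<Rightarrow> nat \<Rightarrow> real).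
              (\<forall>i<m. (\<lambda>x. f x i) \<in> Linf \<Omega>) \<longrightarrow>
              (\<exists>r :: nat \<Rightarrow> nat. strict_mono r \<and>
                 (\<forall>i<m. (\<lambda>k. ba_integral \<Omega> (\<mu> (r k)) (\<lambda>x. f x i))
                           \<longlonglongrightarrow> ba_integral \<Omega> \<nu> (\<lambda>x. f x i))))"
    by (intro bexI[of _ \<nu>] conjI allI impI)
qed

end
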